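(* Let $(\tau_n^{\infty})_{n\ge0}$ be the random tree that doubles everywhere. For all $n\ge1$, $$\mathbb E\big[|\tau_n^{\infty}|\big]\ \ge\ \frac{n-1}{2}\,\log_2\!\Big(\frac{n-1}{\mathrm e}\Big),$$ where for $n=1$ the right-hand side is interpreted as $0$.
   Context: Trees (Ulam--Harris notation): a tree is a set $\tau$ of finite words over the alphabet $\{1,2,3,\ldots\}$ such that every prefix of a word of $\tau$ (including the empty word $\varnothing$, called the root) is in $\tau$. Elements of $\tau$ are called nodes; $|\tau|$ is the number of nodes. The (non-strict) descendants of a node $u\in\tau$ are the nodes of $\tau$ having $u$ as a prefix (including $u$ itself). The random tree that doubles everywhere $(\tau^\infty_n)_{n\ge0}$ is defined by $\tau_0^\infty=\{\varnothing\}$ and, for all $n\ge0$, given $\tau_n^\infty$ (and the past): pick a node $\nu_n$ uniformly at random in $\tau_n^\infty$, let $t_n$ be the set of (non-strict) descendants of $\nu_n$ in $\tau_n^\infty$, and set $$\tau_{n+1}^\infty=(\tau_n^\infty\setminus t_n)\cup\{\nu_n\}\cup\{\nu_n1w:\nu_nw\in\tau_n^\infty\}\cup\{\nu_n2w:\nu_nw\in\tau_n^\infty\},$$ where $w$ ranges over finite words (including the empty word). In other words, the subtree rooted at $\nu_n$ is replaced by a new node to which two copies of that subtree are attached. *)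

theory Defs
  imports "HOL-Probability.Probability" "HOL-Library.Sublist"
begin

definition is_tree :: "nat list set \<Rightarrow> bool" where
  "is_tree t \<longleftrightarrow>
     [] \<in> t \<and> (\<forall>u\<in>t. 0 \<notin> set u) \<and> (\<forall>u\<in>t. \<forall>v. prefix v u \<longrightarrow> v \<in> t)"

definition descendants :: "nat list set \<Rightarrow> nat list \<Rightarrow> nat list set" where
  "descendants t u = {v \<in> t. prefix u v}"

definition double_at :: "nat list set \<Rightarrow> nat list \<Rightarrow> nat list set" where
  "double_at t u =
     (t - descendants t u) \<union> {u} \<union>
     {u @ [1] @ w |w. u @ w \<in> t} \<union> {u @ [2] @ w |w. u @ w \<in> t}"

text \<open>The process is a time-homogeneous Markov chain on finite trees; \<open>doubling_tree n\<close> is the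
  law of its state at time \<open>n\<close>. The uniform choice \<^const>\<open>pmf_of_set\<close> is only meaningful on
  finite nonempty sets, which is guaranteed by \<open>doubling_tree_finite_tree\<close> below.\<close>

primrec doubling_tree :: "nat \<Rightarrow> nat list set pmf" where
  "doubling_tree 0 = return_pmf {[]}"
| "doubling_tree (Suc n) =
     do {
       t \<leftarrow> doubling_tree n;
       u \<leftarrow> pmf_of_set t;
       return_pmf (double_at t u)
     }"

lemma finite_double_at:
  assumes "finite t"
  shows "finite (double_at t u)"
proof -
  have fin: "finite {w. u @ w \<in> t}"
    using finite_vimageI[OF assms, of "(@) u"] by (simp add: vimage_def inj_on_def)
  have "{u @ [a] @ w |w. u @ w \<in> t} = (\<lambda>w. u @ [a] @ w) ` {w. u @ w \<in> t}" for a
    by auto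
  then have "finite {u @ [a] @ w |w. u @ w \<in> t}" for a
    using fin by simp
  then show ?thesis
    using assms unfolding double_at_def by blast
qed

lemma is_tree_double_at:
  assumes t: "is_tree t" and u: "u \<in> t"
  shows "is_tree (double_at t u)"
proof -
  have pre: "\<And>v w. w \<in> t \<Longrightarrow> prefix v w \<Longrightarrow> v \<in> t" and pos: "\<And>v. v \<in> t \<Longrightarrow> 0 \<notin> set v"
    using t unfolding is_tree_def by blast+
  have below: "v \<in> double_at t u" if "prefix v u" for v
    using that u pre[OF u that] prefix_order.antisym
    unfolding double_at_def descendants_def by blast
  have copy: "v \<in> double_at t u"
    if a: "a = 1 \<or> a = 2" and w: "u @ w \<in> t" and v: "prefix v (u @ [a] @ w)" for a v w
  proof (cases "prefix v u")
    case True
    then show ?thesis by (rule below)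
  next
    case False
    then obtain w' where "v = u @ [a] @ w'" "prefix w' w"
      using v by (auto simp: prefix_append prefix_Cons)
    moreover from this have "u @ w' \<in> t"
      using pre[OF w, of "u @ w'"] by simp
    ultimately show ?thesis
      using a unfolding double_at_def by blast
  qed
  have outside: "v \<in> double_at t u"
    if "w \<in> t" "\<not> prefix u w" "prefix v w" for v w
    using that pre[OF that(1,3)] prefix_order.trans
    unfolding double_at_def descendants_def by blast
  show ?thesis
    unfolding is_tree_def
  proof (intro conjI ballI allI impI)
    show "[] \<in> double_at t u"
      by (rule below) simp
  next
    fix v assume "v \<in> double_at t u"
    then show "0 \<notin> set v"
      using pos u pos[of "u @ _"] unfolding double_at_def by fastforce
  next
    fix w v assume "w \<in> double_at t u" "prefix v w"
    then show "v \<in> double_at t u"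
      using below copy outside unfolding double_at_def[of t u] descendants_def by blast
  qed
qed

lemma doubling_tree_finite_tree:
  assumes "t \<in> set_pmf (doubling_tree n)"
  shows "finite t \<and> is_tree t"
  using assms
proof (induction n arbitrary: t)
  case 0
  then show ?case by (simp add: is_tree_def)
next
  case (Suc n)
  then obtain s u where s: "s \<in> set_pmf (doubling_tree n)" "u \<in> set_pmf (pmf_of_set s)"
    and [simp]: "t = double_at s u"
    by auto
  have fin: "finite s" "is_tree s"
    using Suc.IH[OF s(1)] by auto
  then have "s \<noteq> {}"
    by (auto simp: is_tree_def)
  then have "u \<in> s"
    using s(2) fin by (simp add: set_pmf_of_set)
  then show ?case
    using fin finite_double_at is_tree_double_at by simp
qed

end

(* Doubling at u adds |descendants of u| + 1 nodes. Averaged over a uniform u this is 2 plus the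
   mean depth of the tree, because the subtree sizes add up to the sum of (depth + 1). The nodes are
   words over {1, 2}, so the sum of 4^(-depth) is at most 2, and Gibbs' inequality gives mean
   depth at least (log2 |t| - 1) / 2. As |tree at time n| > n, the expected size grows by at least
   (log2 n) / 2 in step n, and these increments dominate those of the convex function
   (x / 2) log2 (x / e). *)

theory Submission
  imports Defs
begin

text \<open>The old subtree is lost, and one new node and two copies of that subtree are gained.
  Each word extending \<open>u\<close> by 1 or by 2 lies in exactly one copy, and the rest of the
  tree does not extend \<open>u\<close>, so the pieces are disjoint.\<close>

lemma card_double_at:
  assumes fin: "finite t" and u: "u \<in> t"
  shows "card (double_at t u) = card t + card (descendants t u) + 1"
proof -
  define D where "D = descendants t u"
  define B where "B = (\<lambda>a::nat. {u @ [a] @ w |w. u @ w \<in> t})"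
  have D_sub: "D \<subseteq> t" and finD: "finite D"
    using fin by (auto simp: D_def descendants_def)
  \<comment> \<open>Indexing each copy by \<open>D\<close> itself makes its cardinality that of
    \<open>D\<close> by injectivity.\<close>
  have B_image: "B a = (\<lambda>v. u @ [a] @ drop (length u) v) ` D" for a
    by (force simp: B_def D_def descendants_def prefix_def)
  have "inj_on (\<lambda>v. u @ [a] @ drop (length u) v) D" for a
    by (auto simp: inj_on_def D_def descendants_def prefix_def)
  then have card_B: "card (B a) = card D" and finB: "finite (B a)" for a
    using finD by (simp_all add: B_image card_image)
  have "card (double_at t u) = card (((t - D) \<union> {u}) \<union> (B 1 \<union> B 2))"
    by (simp add: double_at_def D_def B_def Un_assoc)
  also have "\<dots> = card ((t - D) \<union> {u}) + card (B 1 \<union> B 2)"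
    using fin finB by (intro card_Un_disjoint) (auto simp: B_def D_def descendants_def)
  also have "card (B 1 \<union> B 2) = card D + card D"
    using finB card_B by (subst card_Un_disjoint) (auto simp: B_def)
  also have "card ((t - D) \<union> {u}) = card (t - D) + 1"
    using fin u by (subst card_Un_disjoint) (auto simp: D_def descendants_def)
  also have "card (t - D) = card t - card D"
    using finD D_sub by (rule card_Diff_subset)
  finally show ?thesis
    using card_mono[OF fin D_sub] by (simp add: D_def)
qed

text \<open>Double counting of the pairs in which \<open>u\<close> is a prefix of \<open>v\<close>:
  since the tree is prefix-closed, a node \<open>v\<close> occurs with all of its
  \<open>length v + 1\<close> prefixes.\<close>

lemma sum_card_descendants:
  assumes fin: "finite t" and tree: "is_tree t"
  shows "(\<Sum>u\<in>t. card (descendants t u)) = (\<Sum>v\<in>t. length v + 1)"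
proof -
  have "(\<Sum>u\<in>t. card (descendants t u)) = (\<Sum>v\<in>t. card {u \<in> t. prefix u v})"
    using sum.swap_restrict[OF fin fin, of "\<lambda>_ _. 1::nat" "\<lambda>u v. prefix u v"]
    by (simp add: descendants_def)
  also have "\<dots> = (\<Sum>v\<in>t. length v + 1)"
  proof (rule sum.cong)
    fix v assume "v \<in> t"
    then have "{u \<in> t. prefix u v} = set (prefixes v)"
      using tree by (auto simp: is_tree_def)
    then show "card {u \<in> t. prefix u v} = length v + 1"
      by (simp add: distinct_card)
  qed simp
  finally show ?thesis .
qed

text \<open>There are at most 2^d words of length d, so level d has weight at most 2^(-d). The base
  4 makes the bound independent of the height.\<close>

lemma sum_quarter_power_length_le:
  fixes S :: "'a list set"
  assumes fin: "finite S" and A: "finite A" "card A \<le> 2" and sub: "S \<subseteq> lists A"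
  shows "(\<Sum>w\<in>S. (1/4::real) ^ length w) \<le> 2"
proof -
  obtain h where h: "length ` S \<subseteq> {..<h}"
    using finite_nat_iff_bounded fin by blast
  have "(\<Sum>w\<in>S. (1/4::real) ^ length w) = (\<Sum>d<h. \<Sum>w\<in>{w \<in> S. length w = d}. (1/4) ^ length w)"
    by (rule sum.group[symmetric]) (use fin h in auto)
  also have "\<dots> \<le> (\<Sum>d<h. (1/2) ^ d)"
  proof (rule sum_mono)
    fix d
    have "card {w \<in> S. length w = d} \<le> card {w. set w \<subseteq> A \<and> length w = d}"
      using sub by (intro card_mono finite_lists_length_eq A) auto
    also have "\<dots> \<le> 2 ^ d"
      using A by (simp add: card_lists_length_eq power_mono)
    finally have "real (card {w \<in> S. length w = d}) \<le> 2 ^ d"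
      by (metis of_nat_le_iff of_nat_numeral of_nat_power)
    then have "real (card {w \<in> S. length w = d}) * (1/4) ^ d \<le> 2 ^ d * (1/4) ^ d"
      by (rule mult_right_mono) simp
    also have "\<dots> = (1/2) ^ d"
      by (simp flip: power_mult_distrib)
    finally show "(\<Sum>w\<in>{w \<in> S. length w = d}. (1/4::real) ^ length w) \<le> (1/2) ^ d"
      by simp
  qed
  also have "\<dots> \<le> (\<Sum>d. (1/2::real) ^ d)"
    by (rule sum_le_suminf) auto
  also have "\<dots> = 2"
    by (simp add: suminf_geometric)
  finally show ?thesis .
qed

lemma sum_length_ge:
  fixes S :: "'a list set"
  assumes fin: "finite S" and "S \<noteq> {}" and A: "finite A" "card A \<le> 2" "S \<subseteq> lists A"
  shows "card S * ((log 2 (card S) - 1) / 2) \<le> (\<Sum>w\<in>S. length w)"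
proof -
  define N where "N = real (card S)"
  have N: "N > 0"
    using assms by (simp add: N_def card_gt_0_iff)
  \<comment> \<open>Gibbs' inequality through \<open>ln x \<le> x - 1\<close>, with x the ratio of
    the weight (1/2) 4^(-length) to the uniform weight 1/N. The factor 1/2 gives total weight at
    most 1, so the right-hand sides sum to at most 0.\<close>
  have "ln (N/2) - 2 * ln 2 * real (length w) \<le> N/2 * (1/4) ^ length w - 1" for w :: "'a list"
  proof -
    have "ln (N/2 * (1/4) ^ length w) \<le> N/2 * (1/4) ^ length w - 1"
      using N by (intro ln_le_minus_one) simp
    moreover have "ln (1/4::real) = - 2 * ln 2"
      using ln_realpow[of 2 2] by (simp add: ln_div)
    ultimately show ?thesis
      using N by (subst (asm) ln_mult) (auto simp: ln_realpow algebra_simps)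
  qed
  then have "(\<Sum>w\<in>S. ln (N/2) - 2 * ln 2 * real (length w)) \<le> (\<Sum>w\<in>S. N/2 * (1/4) ^ length w - 1)"
    by (rule sum_mono)
  then have "N * ln (N/2) - 2 * ln 2 * (\<Sum>w\<in>S. length w) \<le> N/2 * (\<Sum>w\<in>S. (1/4) ^ length w) - N"
    by (simp add: sum_subtractf sum_distrib_left N_def)
  also have "\<dots> \<le> N/2 * 2 - N"
    using N sum_quarter_power_length_le[OF fin A]
    by (intro diff_right_mono mult_left_mono) auto
  finally have "N * (ln N - ln 2) \<le> 2 * ln 2 * (\<Sum>w\<in>S. length w)"
    using N by (simp add: ln_div)
  then have "N * ((ln N / ln 2 - 1) / 2) \<le> (\<Sum>w\<in>S. length w)"
    by (simp add: field_simps)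
  then show ?thesis
    by (simp add: N_def log_def)
qed

lemma mean_card_double_at_ge:
  assumes fin: "finite t" and tree: "is_tree t" and bin: "t \<subseteq> lists {1, 2}"
  shows "measure_pmf.expectation (pmf_of_set t) (\<lambda>u. real (card (double_at t u)))
           \<ge> card t + log 2 (card t) / 2"
proof -
  have ne: "t \<noteq> {}"
    using tree by (auto simp: is_tree_def)
  then have pos: "card t > 0"
    using fin by (simp add: card_gt_0_iff)
  have "(\<Sum>u\<in>t. card (double_at t u)) = (\<Sum>u\<in>t. card t + card (descendants t u) + 1)"
    by (rule sum.cong) (simp_all add: card_double_at[OF fin])
  also have "\<dots> = card t * card t + 2 * card t + (\<Sum>w\<in>t. length w)"
    using sum_card_descendants[OF fin tree] by (simp add: sum.distrib sum_Suc)
  finally have sum_eq: "(\<Sum>u\<in>t. real (card (double_at t u)))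
      = card t * card t + 2 * card t + (\<Sum>w\<in>t. length w)"
    by (simp flip: of_nat_sum)
  \<comment> \<open>The mean growth is at least 2 + (log2 N - 1) / 2 with N the size of
    \<open>t\<close>; the surplus 3/2 over (log2 N) / 2 is dropped.\<close>
  have "(card t + log 2 (card t) / 2) * card t
      \<le> card t * card t + 2 * card t + card t * ((log 2 (card t) - 1) / 2)"
    by (simp add: field_simps)
  also have "\<dots> \<le> (\<Sum>u\<in>t. real (card (double_at t u)))"
    unfolding sum_eq using sum_length_ge[OF fin ne _ _ bin] by simp
  finally show ?thesis
    using pos by (simp add: integral_pmf_of_set[OF ne fin] pos_le_divide_eq)
qed

lemma doubling_tree_Suc_cases:
  assumes "t \<in> set_pmf (doubling_tree (Suc n))"
  obtains s u where "s \<in> set_pmf (doubling_tree n)" "u \<in> s" "t = double_at s u"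
proof -
  obtain s u where s: "s \<in> set_pmf (doubling_tree n)" "u \<in> set_pmf (pmf_of_set s)"
    and t: "t = double_at s u"
    using assms by auto
  moreover have "finite s" "s \<noteq> {}"
    using doubling_tree_finite_tree[OF s(1)] by (auto simp: is_tree_def)
  ultimately show thesis
    using that by simp
qed

text \<open>Supplies the two-letter alphabet required by \<open>sum_length_ge\<close>: doubling
  inserts only the letters 1 and 2.\<close>

lemma doubling_tree_binary:
  "t \<in> set_pmf (doubling_tree n) \<Longrightarrow> t \<subseteq> lists {1, 2}"
proof (induction n arbitrary: t)
  case (Suc n)
  obtain s u where s: "s \<in> set_pmf (doubling_tree n)" "u \<in> s" "t = double_at s u"
    using Suc.prems by (rule doubling_tree_Suc_cases)
  have IH: "s \<subseteq> lists {1, 2}"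
    using s(1) by (rule Suc.IH)
  have copy: "u @ [a] @ w \<in> lists {1, 2}" if "u @ w \<in> s" "a \<in> {1, 2}" for a w
    using subsetD[OF IH that(1)] that(2) by simp
  show ?case
  proof
    fix v assume "v \<in> t"
    then consider "v \<in> s" | "v = u" | a w where "u @ w \<in> s" "a \<in> {1, 2}" "v = u @ [a] @ w"
      unfolding s(3) double_at_def by blast
    then show "v \<in> lists {1, 2}"
      using IH s(2) copy by cases blast+
  qed
qed simp

lemma card_doubling_tree_gt:
  "t \<in> set_pmf (doubling_tree n) \<Longrightarrow> card t > n"
proof (induction n arbitrary: t)
  case (Suc n)
  obtain s u where s: "s \<in> set_pmf (doubling_tree n)" "u \<in> s" "t = double_at s u"
    using Suc.prems by (rule doubling_tree_Suc_cases)
  then show ?case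
    using Suc.IH[OF s(1)] doubling_tree_finite_tree[OF s(1)] by (simp add: card_double_at)
qed simp

lemma set_pmf_of_set_doubling_tree:
  "t \<in> set_pmf (doubling_tree n) \<Longrightarrow> set_pmf (pmf_of_set t) = t \<and> finite t"
  using doubling_tree_finite_tree[of t n] by (metis empty_iff is_tree_def set_pmf_of_set)

text \<open>Turns expectations over the process into finite sums.\<close>

lemma finite_set_pmf_doubling_tree: "finite (set_pmf (doubling_tree n))"
  by (induction n) (auto simp: set_pmf_of_set_doubling_tree)

text \<open>Condition on the tree at time \<open>n\<close>. Every possible tree has more than
  \<open>n\<close> nodes, so its random logarithm is bounded below by the constant
  \<open>log 2 n\<close> before averaging.\<close>

lemma expectation_doubling_tree_Suc_ge:
  assumes n: "n \<ge> 1"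
  shows "measure_pmf.expectation (doubling_tree (Suc n)) (\<lambda>t. real (card t))
    \<ge> measure_pmf.expectation (doubling_tree n) (\<lambda>t. real (card t)) + log 2 n / 2"
proof -
  define P where "P = doubling_tree n"
  have fin: "finite (set_pmf P)"
    by (simp add: P_def finite_set_pmf_doubling_tree)
  have "measure_pmf.expectation P (\<lambda>t. real (card t)) + log 2 n / 2
      = (\<Sum>t\<in>set_pmf P. pmf P t * (card t + log 2 n / 2))"
    using sum_pmf_eq_1[OF fin]
    by (simp add: integral_measure_pmf[OF fin] distrib_left sum.distrib
        flip: sum_distrib_right sum_divide_distrib)
  also have "\<dots> \<le> (\<Sum>t\<in>set_pmf P. pmf P t *
      measure_pmf.expectation (pmf_of_set t) (\<lambda>u. real (card (double_at t u))))"
  proof (intro sum_mono mult_left_mono)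
    fix t assume t: "t \<in> set_pmf P"
    have "log 2 n \<le> log 2 (card t)"
      using n card_doubling_tree_gt[of t n] t by (simp add: P_def)
    then have "card t + log 2 n / 2 \<le> card t + log 2 (card t) / 2"
      by simp
    also have "\<dots> \<le> measure_pmf.expectation (pmf_of_set t) (\<lambda>u. real (card (double_at t u)))"
      using t doubling_tree_finite_tree[of t n] doubling_tree_binary[of t n]
      by (intro mean_card_double_at_ge) (auto simp: P_def)
    finally show "card t + log 2 n / 2
        \<le> measure_pmf.expectation (pmf_of_set t) (\<lambda>u. real (card (double_at t u)))" .
  qed simp
  also have "\<dots> = measure_pmf.expectation (doubling_tree (Suc n)) (\<lambda>t. real (card t))"
    unfolding doubling_tree.simps P_def[symmetric]
    by (subst pmf_expectation_bind[OF fin])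
      (auto simp: P_def set_pmf_of_set_doubling_tree simp flip: map_pmf_def)
  finally show ?thesis
    by (simp only: P_def)
qed

text \<open>The function f(x) = (x / 2) log2 (x / e) is convex with f'(x) = (log2 x) / 2, so its
  increment over [n - 1, n] is at most f'(n).\<close>

lemma half_log_increment_le:
  fixes n :: nat
  assumes n: "n \<ge> 1"
  shows "real n / 2 * log 2 (real n / exp 1)
    \<le> (real n - 1) / 2 * log 2 ((real n - 1) / exp 1) + log 2 n / 2"
proof (cases "n = 1")
  case True
  then show ?thesis
    by (simp add: log_def ln_div)
next
  case False
  define m where "m = real n - 1"
  have m: "m > 0" and n_eq: "real n = m + 1"
    using False n by (auto simp: m_def)
  \<comment> \<open>The tangent bound for \<open>ln\<close> at 1 replaces the derivative argument;
    its right-hand side is 1/m.\<close>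
  have "ln ((m + 1) / m) \<le> (m + 1) / m - 1"
    using m by (intro ln_le_minus_one) simp
  then have "m * (ln (m + 1) - ln m) \<le> 1"
    using m by (simp add: ln_div field_simps)
  then have "(m + 1) * (ln (m + 1) - 1) \<le> m * (ln m - 1) + ln (m + 1)"
    by (simp add: algebra_simps)
  then have "(m + 1) * (ln (m + 1) - 1) / (2 * ln 2)
      \<le> (m * (ln m - 1) + ln (m + 1)) / (2 * ln 2)"
    by (rule divide_right_mono) simp
  then show ?thesis
    using m by (simp add: n_eq log_def ln_div mult.commute flip: add_divide_distrib)
qed

theorem proposition5p1:
  fixes n :: nat
  assumes "n \<ge> 1"
  shows "measure_pmf.expectation (doubling_tree n) (\<lambda>t. real (card t))
           \<ge> (real n - 1) / 2 * log 2 ((real n - 1) / exp 1)"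
  using assms
proof (induction n rule: nat_induct_at_least)
  case base
  \<comment> \<open>At \<open>n = 1\<close> the factor \<open>real n - 1\<close> vanishes, so the
    bound is 0 as the convention demands, whatever the value of \<open>log 2 0\<close>.\<close>
  then show ?case by simp
next
  case (Suc n)
  then show ?case
    using half_log_increment_le[OF Suc.hyps] expectation_doubling_tree_Suc_ge[OF Suc.hyps]
    by simp
qed

end
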